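(* Neither the coverage measure $I_C$ nor the directed coverage measure $I_{DC}$ satisfies extremism monotonicity.
   Context: For $x,y\in\mathbb{R}^d$, $y$ dominates $x$ if $x_i\le y_i$ for all $i\in[d]$ and $x_j<y_j$ for some $j\in[d]$. A set of alternatives is a finite set $A\subseteq\mathbb{R}^d$ ($d\ge 1$ arbitrary) none of whose elements is dominated by another element of $A$. Let $\|x-y\|=\sum_{i=1}^d|x_i-y_i|$ and $\|x-y\|_+=\sum_{i=1}^d\max(x_i-y_i,0)$. For a finite set $B\subseteq\mathbb{R}^d$ and nonempty $S\subseteq B$, $I_C(S,B)=\max_{a\in B}\min_{s\in S}\|a-s\|$ and $I_{DC}(S,B)=\max_{a\in B}\min_{s\in S}\|a-s\|_+$ (lower is better for both). For a positive integer $k$, $\mathcal{S}(I,B,k)$ is the set of all $S\subseteq B$ with $|S|=k$ minimizing $I(S,B)$ among the size-$k$ subsets of $B$. Extremism monotonicity of a measure $I$: for any set of alternatives $A$, $k\in\mathbb{N}$, $t>0$, and $S\in\mathcal{S}(I,A,k)$ with $x\in S$: if for some objective $i\in[d]$ we have $x_i=\max_{a\in A}a_i$ (resp. $x_i=\min_{a\in A}a_i$), then there exists $S'\in\mathcal{S}(I,(A\setminus\{x\})\cup\{x'\},k)$ with $x'\in S'$, where $x'_i:=x_i+t$ (resp. $x'_i:=x_i-t$) and $x'_j:=x_j$ for all $j\in[d]\setminus\{i\}$. *)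

theory Defs
  imports "Jordan_Normal_Form.Matrix"
begin

text \<open>
  Points of \<open>\<real>\<^sup>d\<close> are the elements of \<^term>\<open>carrier_vec d :: real vec set\<close>; a measure is
  defined simultaneously for all \<open>d\<close>, so the dimension has to be a term rather than a type.
  The coordinates are numbered \<open>0, \<dots>, d - 1\<close>.
\<close>

definition dominates :: "real vec \<Rightarrow> real vec \<Rightarrow> bool" where
  "dominates y x \<longleftrightarrow> (\<forall>i<dim_vec x. x $ i \<le> y $ i) \<and> (\<exists>j<dim_vec x. x $ j < y $ j)"

definition set_of_alternatives :: "nat \<Rightarrow> real vec set \<Rightarrow> bool" where
  "set_of_alternatives d A \<longleftrightarrow>
     1 \<le> d \<and> finite A \<and> A \<subseteq> carrier_vec d \<and> (\<forall>x\<in>A. \<forall>y\<in>A. \<not> dominates y x)"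

definition dist_l1 :: "real vec \<Rightarrow> real vec \<Rightarrow> real" where
  "dist_l1 x y = (\<Sum>i<dim_vec x. \<bar>x $ i - y $ i\<bar>)"

definition dist_plus :: "real vec \<Rightarrow> real vec \<Rightarrow> real" where
  "dist_plus x y = (\<Sum>i<dim_vec x. max (x $ i - y $ i) 0)"

text \<open>
  A measure takes the selected set \<open>S\<close> and the ground set \<open>B\<close>. The values below are meaningful
  only for finite \<open>B\<close> and \<open>{} \<noteq> S \<subseteq> B\<close>, since \<^term>\<open>Min\<close> and \<^term>\<open>Max\<close> are unspecified on
  empty and infinite sets; they are used only in that case.
\<close>

type_synonym measure_fun = "real vec set \<Rightarrow> real vec set \<Rightarrow> real"

definition coverage :: measure_fun where
  "coverage S B = (MAX a\<in>B. MIN s\<in>S. dist_l1 a s)"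

definition directed_coverage :: measure_fun where
  "directed_coverage S B = (MAX a\<in>B. MIN s\<in>S. dist_plus a s)"

definition optimal_subsets :: "measure_fun \<Rightarrow> real vec set \<Rightarrow> nat \<Rightarrow> real vec set set" where
  "optimal_subsets I B k =
     {S. S \<subseteq> B \<and> card S = k \<and> (\<forall>T. T \<subseteq> B \<and> card T = k \<longrightarrow> I S B \<le> I T B)}"

definition shift_coord :: "real vec \<Rightarrow> nat \<Rightarrow> real \<Rightarrow> real vec" where
  "shift_coord x i t = vec (dim_vec x) (\<lambda>j. if j = i then x $ i + t else x $ j)"

text \<open>
  The maximum and the minimum case are both part of the property. The modified ground set need not
  be a set of alternatives again.
\<close>

definition extremism_monotone :: "measure_fun \<Rightarrow> bool" where
  "extremism_monotone I \<longleftrightarrow>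
     (\<forall>d A k t S x i.
        set_of_alternatives d A \<longrightarrow> 1 \<le> k \<longrightarrow> 0 < t \<longrightarrow>
        S \<in> optimal_subsets I A k \<longrightarrow> x \<in> S \<longrightarrow> i < d \<longrightarrow>
        (x $ i = (MAX a\<in>A. a $ i) \<longrightarrow>
           (\<exists>S'\<in>optimal_subsets I ((A - {x}) \<union> {shift_coord x i t}) k. shift_coord x i t \<in> S')) \<and>
        (x $ i = (MIN a\<in>A. a $ i) \<longrightarrow>
           (\<exists>S'\<in>optimal_subsets I ((A - {x}) \<union> {shift_coord x i (- t)}) k.
              shift_coord x i (- t) \<in> S')))"

end

theory Submission imports Defs begin

text \<open>
  Both measures fail already for \<open>k = 1\<close>, in the minimum case, on the collinear points
  \<open>x = (0,0,0)\<close>, \<open>y = (0,1,-1)\<close>, \<open>z = (0,-2,2)\<close>. The middle point \<open>x\<close> is the optimal centre, and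
  it is minimal in the first objective because all three points tie there. Lowering that
  objective of \<open>x\<close> by 3 adds 3 to its (directed) distance from the far point \<open>z\<close>, which \<open>y\<close>
  covers without this detour, so \<open>y\<close> becomes strictly better than the shifted point.
\<close>

text \<open>With \<open>k = 1\<close>, the only candidate \<open>S'\<close> containing the shifted
  point is its singleton, so one strictly better singleton refutes the property. Choosing
  \<open>y\<close> from \<open>A - {x}\<close> keeps it in the ground set after the shift.\<close>

lemma not_extremism_monotoneI:
  assumes "set_of_alternatives d A" "x \<in> A" "i < d" "0 < t" "x $ i = (MIN a\<in>A. a $ i)"
    and opt: "\<And>a. a \<in> A \<Longrightarrow> I {x} A \<le> I {a} A"
    and y: "y \<in> A - {x}"
      "I {y} ((A - {x}) \<union> {shift_coord x i (- t)}) <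
       I {shift_coord x i (- t)} ((A - {x}) \<union> {shift_coord x i (- t)})"
  shows "\<not> extremism_monotone I"
proof
  assume "extremism_monotone I"
  moreover have "{x} \<in> optimal_subsets I A 1"
    using \<open>x \<in> A\<close> opt by (auto simp: optimal_subsets_def card_1_singleton_iff)
  ultimately obtain S' where
    S': "S' \<in> optimal_subsets I ((A - {x}) \<union> {shift_coord x i (- t)}) 1" "shift_coord x i (- t) \<in> S'"
    using assms(1-5) unfolding extremism_monotone_def by blast
  then have "S' = {shift_coord x i (- t)}"
    by (auto simp: optimal_subsets_def card_1_singleton_iff)
  moreover have "I S' ((A - {x}) \<union> {shift_coord x i (- t)}) \<le> I {y} ((A - {x}) \<union> {shift_coord x i (- t)})"
    using S'(1) y(1) unfolding optimal_subsets_def by simp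
  ultimately show False
    using y(2) by simp
qed

definition vec3 :: "real \<Rightarrow> real \<Rightarrow> real \<Rightarrow> real vec" where
  "vec3 a b c = vec_of_list [a, b, c]"

lemma dim_vec3 [simp]: "dim_vec (vec3 a b c) = 3"
  by (simp add: vec3_def)

lemma vec3_index [simp]:
  "vec3 a b c $ 0 = a" "vec3 a b c $ Suc 0 = b" "vec3 a b c $ 2 = c"
  by (simp_all add: vec3_def vec_of_list_index numeral_2_eq_2)

lemma less_3_iff: "i < (3::nat) \<longleftrightarrow> i = 0 \<or> i = Suc 0 \<or> i = 2"
  by auto

lemma lessThan_3: "{..<3::nat} = {0, Suc 0, 2}"
  by (auto simp: less_3_iff)

text \<open>Decides which points are distinct, so that \<open>A - {x}\<close> can be evaluated
  explicitly.\<close>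

lemma vec3_eq_iff [simp]: "vec3 a b c = vec3 a' b' c' \<longleftrightarrow> a = a' \<and> b = b' \<and> c = c'"
  by (metis vec3_index)

lemma shift_coord_vec3: "shift_coord (vec3 a b c) 0 t = vec3 (a + t) b c"
  by (rule eq_vecI) (auto simp: shift_coord_def less_3_iff)

lemma dist_l1_vec3:
  "dist_l1 (vec3 a b c) (vec3 a' b' c') = \<bar>a - a'\<bar> + \<bar>b - b'\<bar> + \<bar>c - c'\<bar>"
  by (simp add: dist_l1_def lessThan_3)

lemma dist_plus_vec3:
  "dist_plus (vec3 a b c) (vec3 a' b' c') = max (a - a') 0 + max (b - b') 0 + max (c - c') 0"
  by (simp add: dist_plus_def lessThan_3)

lemma dominates_vec3:
  "dominates (vec3 a b c) (vec3 a' b' c') \<longleftrightarrow>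
     a' \<le> a \<and> b' \<le> b \<and> c' \<le> c \<and> (a' < a \<or> b' < b \<or> c' < c)"
proof -
  have "(\<forall>i<3. P i) \<longleftrightarrow> P 0 \<and> P (Suc 0) \<and> P 2"
    and "(\<exists>i<3. P i) \<longleftrightarrow> P 0 \<or> P (Suc 0) \<or> P 2" for P :: "nat \<Rightarrow> bool"
    unfolding less_3_iff by blast+
  then show ?thesis
    by (simp add: dominates_def)
qed

theorem proposition18:
  "\<not> extremism_monotone coverage \<and> \<not> extremism_monotone directed_coverage"
proof -
  define x where "x = vec3 0 0 0"
  define y where "y = vec3 0 1 (- 1)"
  define z where "z = vec3 0 (- 2) 2"
  define A where "A = {x, y, z}"
  note defs = A_def x_def y_def z_def
  have alternatives: "set_of_alternatives 3 A"
    by (simp add: defs set_of_alternatives_def dominates_vec3 carrier_vecI)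
  have members: "x \<in> A" "y \<in> A - {x}" and min: "x $ 0 = (MIN a\<in>A. a $ 0)"
    by (simp_all add: defs)
  have shifted: "(A - {x}) \<union> {shift_coord x 0 (- 3)} = {y, z, vec3 (- 3) 0 0}"
    by (auto simp: defs shift_coord_vec3)
  have shift: "shift_coord x 0 (- 3) = vec3 (- 3) 0 0"
    by (simp add: defs shift_coord_vec3)
  have "\<not> extremism_monotone coverage"
  \<comment> \<open>After a shift by \<open>t\<close>, the shifted point has coverage
    \<open>t + 4\<close>, attained at \<open>z\<close>, and \<open>y\<close> has
    \<open>max 6 (t + 2)\<close>; any \<open>t > 2\<close> separates them.\<close>
  proof (rule not_extremism_monotoneI[OF alternatives members(1) _ _ min _ members(2), where t = 3])
    \<comment> \<open>The centres \<open>x\<close>, \<open>y\<close>, \<open>z\<close> have coverage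
      4, 6, 6.\<close>
    show "coverage {x} A \<le> coverage {a} A" if "a \<in> A" for a
      using that by (auto simp: defs coverage_def dist_l1_vec3)
  qed (unfold shifted shift, simp_all add: defs coverage_def dist_l1_vec3)
  moreover have "\<not> extremism_monotone directed_coverage"
  \<comment> \<open>Now the shifted point has value \<open>t + 2\<close>, again attained at
    \<open>z\<close>, while \<open>y\<close> has value 3 for every \<open>t > 0\<close>, so the same
    \<open>t\<close> works.\<close>
  proof (rule not_extremism_monotoneI[OF alternatives members(1) _ _ min _ members(2), where t = 3])
    \<comment> \<open>The directed values of \<open>x\<close>, \<open>y\<close>, \<open>z\<close>
      are 2, 3, 3.\<close>
    show "directed_coverage {x} A \<le> directed_coverage {a} A" if "a \<in> A" for a
      using that by (auto simp: defs directed_coverage_def dist_plus_vec3)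
  qed (unfold shifted shift, simp_all add: defs directed_coverage_def dist_plus_vec3)
  ultimately show ?thesis
    by blast
qed

end
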